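(* For every $p$ with $0\le p\le\infty$, the Hardy quasinorm $\|\cdot\|_{H^p}$ on $\mathbb C^2$ is a norm. In addition, it has the symmetry properties $$\|(a_1,a_2)\|_{H^p}=\|(a_2,a_1)\|_{H^p}=\|(|a_1|,|a_2|)\|_{H^p}\quad\text{for all }(a_1,a_2)\in\mathbb C^2.$$
   Context: For $(a_1,a_2)\in\mathbb C^2$ the Hardy quasinorms are defined as follows. For $0<p<\infty$, $\|(a_1,a_2)\|_{H^p}=\left(\frac1{2\pi}\int_0^{2\pi}|a_1+a_2e^{it}|^p\,dt\right)^{1/p}$. For $p=\infty$, $\|(a_1,a_2)\|_{H^\infty}=\max_{t\in\mathbb R}|a_1+a_2e^{it}|$. For $p=0$, $\|(a_1,a_2)\|_{H^0}=\exp\left(\frac1{2\pi}\int_0^{2\pi}\log|a_1+a_2e^{it}|\,dt\right)$ (the Mahler measure of $a_1+a_2z$), with the convention $\exp(-\infty)=0$, so that $\|(0,0)\|_{H^0}=0$. *)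

theory Defs
  imports "HOL-Analysis.Analysis"
begin

text \<open>
  The exponent has type \<^typ>\<open>ennreal\<close>, so \<open>p\<close> ranges over exactly the interval from \<open>0\<close> to
  \<open>\<infinity>\<close>, both endpoints included.

  For \<open>p = 0\<close> the zero vector is split off: there the integrand is identically \<open>-\<infinity>\<close> and the
  value is \<open>exp (-\<infinity>) = 0\<close>, whereas \<open>ln 0 = 0\<close> in HOL. For any other vector
  \<open>a\<^sub>1 + a\<^sub>2 exp (it)\<close> has at most finitely many zeros on the interval of integration, so the
  value of \<open>ln\<close> at \<open>0\<close> does not affect the integral.

  For \<open>p = \<infinity>\<close> the supremum is a maximum, by continuity and periodicity.
\<close>

definition hardy_norm :: "ennreal \<Rightarrow> complex \<times> complex \<Rightarrow> real" where
  "hardy_norm p a =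
     (if p = 0 then
        (if a = (0, 0) then 0
         else exp (1 / (2 * pi) * (LBINT t:{0..2 * pi}. ln (cmod (fst a + snd a * exp (\<i> * of_real t))))))
      else if p = \<infinity> then
        (SUP t::real. cmod (fst a + snd a * exp (\<i> * of_real t)))
      else
        (1 / (2 * pi) * (LBINT t:{0..2 * pi}. cmod (fst a + snd a * exp (\<i> * of_real t)) powr enn2real p))
          powr (1 / enn2real p))"

definition is_norm_C2 :: "(complex \<times> complex \<Rightarrow> real) \<Rightarrow> bool" where
  "is_norm_C2 N \<longleftrightarrow>
     (\<forall>x. 0 \<le> N x) \<and>
     (\<forall>x. N x = 0 \<longleftrightarrow> x = 0) \<and>
     (\<forall>c x. N (c * fst x, c * snd x) = cmod c * N x) \<and>
     (\<forall>x y. N (x + y) \<le> N x + N y)"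

end

theory Submission
  imports Defs
begin

text \<open>
  For \<open>p = 0\<close> and \<open>p = \<infinity>\<close> the quasinorm equals \<open>max \<bar>a\<^sub>1\<bar> \<bar>a\<^sub>2\<bar>\<close> and \<open>\<bar>a\<^sub>1\<bar> + \<bar>a\<^sub>2\<bar>\<close>.
  For \<open>0 < p < \<infinity>\<close>, Parseval gives the mean \<open>m(w)\<close> of \<open>\<bar>1 + w exp (it)\<bar> powr p\<close> as a power
  series in \<open>\<bar>w\<bar>\<^sup>2\<close> with nonnegative coefficients when \<open>\<bar>w\<bar> \<le> 1\<close>. Hence \<open>m\<close> is radial, and
  increasing and convex on \<open>[0, 1]\<close>. If \<open>p < 1\<close>, then \<open>m powr (1 / p)\<close> is convex as well, and so the
  quasinorm is subadditive on the sector \<open>0 \<le> a\<^sub>1 \<le> a\<^sub>2\<close>. The two sectors of the quadrant fit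
  together because \<open>\<bar>x + y exp (it)\<bar>\<^sup>2\<close> is, for real \<open>x, y\<close>, a combination of \<open>(x + y)\<^sup>2\<close> and
  \<open>(x - y)\<^sup>2\<close> with nonnegative coefficients. If \<open>p \<ge> 1\<close>, the triangle inequality is Minkowski's.
\<close>

section \<open>Means over the unit circle and Parseval's identity\<close>

definition circle_mean :: "(real \<Rightarrow> 'a::{banach, second_countable_topology}) \<Rightarrow> 'a" where
  "circle_mean f = (1 / (2 * pi)) *\<^sub>R (LBINT t:{0..2 * pi}. f t)"

lemma circle_mean_const [simp]: "circle_mean (\<lambda>t. c :: 'a::{banach, second_countable_topology}) = c"
proof -
  have "(LBINT t:{0..2 * pi}. c) = (2 * pi) *\<^sub>R c"
    by (simp add: set_lebesgue_integral_def)
  then show ?thesis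
    by (simp add: circle_mean_def)
qed

lemma circle_mean_mono:
  fixes f g :: "real \<Rightarrow> real"
  assumes "continuous_on {0..2 * pi} f" "continuous_on {0..2 * pi} g" "\<And>t. f t \<le> g t"
  shows "circle_mean f \<le> circle_mean g"
  unfolding circle_mean_def
  using assms by (auto intro!: divide_right_mono set_integral_mono borel_integrable_atLeastAtMost')

lemma circle_mean_mult_left: "circle_mean (\<lambda>t. c * f t) = c * circle_mean f"
  for c :: "'a::{real_normed_field, banach, second_countable_topology}"
  by (simp add: circle_mean_def)

lemma circle_mean_minus: "circle_mean (\<lambda>t. - f t) = - circle_mean f"
  by (simp add: circle_mean_def set_lebesgue_integral_def)

lemma circle_mean_add:
  assumes "continuous_on {0..2 * pi} f" "continuous_on {0..2 * pi} g"
  shows "circle_mean (\<lambda>t. f t + g t) = circle_mean f + circle_mean g"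
  using assms by (simp add: circle_mean_def borel_integrable_atLeastAtMost' scaleR_add_right)

lemma circle_mean_sum:
  assumes "finite A" "\<And>k. k \<in> A \<Longrightarrow> continuous_on {0..2 * pi} (f k)"
  shows "circle_mean (\<lambda>t. \<Sum>k\<in>A. f k t) = (\<Sum>k\<in>A. circle_mean (f k))"
  using assms
proof (induction A rule: finite_induct)
  case (insert k A)
  then show ?case
    by (simp add: circle_mean_add continuous_on_sum)
qed simp

lemma circle_mean_Re:
  assumes "continuous_on {0..2 * pi} f"
  shows "circle_mean (\<lambda>t. Re (f t)) = Re (circle_mean f)"
proof -
  have "complex_integrable lborel (\<lambda>t. indicator {0..2 * pi} t *\<^sub>R f t)"
    using borel_integrable_atLeastAtMost'[OF assms] by (simp add: set_integrable_def)
  from integral_Re[OF this] show ?thesis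
    by (simp add: circle_mean_def set_lebesgue_integral_def)
qed

lemma circle_mean_tendsto:
  assumes "\<And>n. continuous_on {0..2 * pi} (s n)" "continuous_on {0..2 * pi} f"
    and "\<And>t. (\<lambda>n. s n t) \<longlonglongrightarrow> f t" "\<And>n t. norm (s n t) \<le> B"
  shows "(\<lambda>n. circle_mean (s n)) \<longlonglongrightarrow> circle_mean f"
  unfolding circle_mean_def set_lebesgue_integral_def
proof (intro tendsto_scaleR tendsto_const integral_dominated_convergence)
  show "(\<lambda>t. indicator {0..2 * pi} t *\<^sub>R f t) \<in> borel_measurable lborel"
    using borel_integrable_atLeastAtMost'[OF assms(2)] by (simp add: set_integrable_def)
  show "(\<lambda>t. indicator {0..2 * pi} t *\<^sub>R s n t) \<in> borel_measurable lborel" for n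
    using borel_integrable_atLeastAtMost'[OF assms(1)] by (simp add: set_integrable_def)
  show "integrable lborel (\<lambda>t. indicator {0..2 * pi} t *\<^sub>R B)"
    using borel_integrable_atLeastAtMost'[of 0 "2 * pi" "\<lambda>_. B"] by (simp add: set_integrable_def)
  show "AE t in lborel. (\<lambda>n. indicator {0..2 * pi} t *\<^sub>R s n t) \<longlonglongrightarrow> indicator {0..2 * pi} t *\<^sub>R f t"
    using assms(3) by (intro AE_I2 tendsto_scaleR tendsto_const)
  show "AE t in lborel. norm (indicator {0..2 * pi} t *\<^sub>R s n t) \<le> indicator {0..2 * pi} t *\<^sub>R B" for n
    using assms(4) by (intro AE_I2) (simp add: indicator_def)
qed

text \<open>Orthogonality of characters: for \<open>m\<close> other than 0 the antiderivative is
  itself periodic. Both Parseval's identity and the mean of the logarithm rest on it.\<close>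

lemma circle_mean_cis:
  "circle_mean (\<lambda>t. cis (of_int m * t)) = (if m = 0 then 1 else 0)"
proof (cases "m = 0")
  case False
  have "((\<lambda>t. cis (of_int m * t) / (\<i> * of_int m)) has_vector_derivative cis (of_int m * t)) (at t within X)" for t X
    unfolding cis_conv_exp using False
    by (auto intro!: derivative_eq_intros has_vector_derivative_real_field simp: field_simps)
  then have "integral\<^sup>L lborel (\<lambda>t. indicator {0..2 * pi} t *\<^sub>R cis (of_int m * t)) =
      cis (of_int m * (2 * pi)) / (\<i> * of_int m) - cis (of_int m * 0) / (\<i> * of_int m)"
    by (intro integral_FTC_atLeastAtMost continuous_intros) auto
  also have "\<dots> = 0"
    using cis_multiple_2pi[of "of_int m"] by (simp add: mult.commute)
  finally show ?thesis
    using False by (simp add: circle_mean_def set_lebesgue_integral_def)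
qed simp

text \<open>Expanding the squared modulus gives a double sum over the frequencies
  \<open>j - k\<close>, of which only the diagonal has nonzero mean.\<close>

lemma parseval_sum:
  "circle_mean (\<lambda>t. (cmod (\<Sum>k<n. c k * cis t ^ k))\<^sup>2) = (\<Sum>k<n. (cmod (c k))\<^sup>2)"
proof -
  have sq: "(\<Sum>k<n. c k * cis t ^ k) * cnj (\<Sum>k<n. c k * cis t ^ k) =
      (\<Sum>j<n. \<Sum>k<n. (c j * cnj (c k)) * cis (of_int (int j - int k) * t))" for t
    unfolding cnj_sum sum_product
  proof (intro sum.cong refl)
    fix j k
    have "cis t ^ j * cnj (cis t ^ k) = cis (of_int (int j - int k) * t)"
      unfolding Complex.DeMoivre cis_cnj cis_mult by (simp add: left_diff_distrib)
    then show "c j * cis t ^ j * cnj (c k * cis t ^ k) = c j * cnj (c k) * cis (of_int (int j - int k) * t)"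
      by (metis complex_cnj_mult mult.assoc mult.left_commute)
  qed
  have "circle_mean (\<lambda>t. (\<Sum>k<n. c k * cis t ^ k) * cnj (\<Sum>k<n. c k * cis t ^ k)) =
      (\<Sum>j<n. \<Sum>k<n. (c j * cnj (c k)) * (if j = k then 1 else 0))"
    unfolding sq
    by (simp add: circle_mean_sum circle_mean_mult_left circle_mean_cis continuous_intros
        del: of_int_diff of_int_of_nat_eq)
  also have "\<dots> = (\<Sum>k<n. c k * cnj (c k))"
    by (intro sum.cong refl) (simp add: if_distrib cong: if_cong)
  \<comment> \<open>The expansion is an identity of complex means; real parts bring it back to the
    real integrand.\<close>
  finally have "Re (circle_mean (\<lambda>t. (\<Sum>k<n. c k * cis t ^ k) * cnj (\<Sum>k<n. c k * cis t ^ k))) =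
      (\<Sum>k<n. (cmod (c k))\<^sup>2)"
    by (simp add: complex_mult_cnj cmod_power2)
  moreover have "continuous_on {0..2 * pi}
      (\<lambda>t. (\<Sum>k<n. c k * cis t ^ k) * cnj (\<Sum>k<n. c k * cis t ^ k))"
    by (intro continuous_intros)
  ultimately have "circle_mean (\<lambda>t. Re ((\<Sum>k<n. c k * cis t ^ k) * cnj (\<Sum>k<n. c k * cis t ^ k))) =
      (\<Sum>k<n. (cmod (c k))\<^sup>2)"
    by (simp only: circle_mean_Re)
  moreover have "Re (z * cnj z) = (cmod z)\<^sup>2" for z :: complex
    by (simp add: complex_mult_cnj cmod_power2)
  ultimately show ?thesis
    by (simp only:)
qed

section \<open>Power means of \<open>a + b z\<close> over the circle\<close>

text \<open>This is the quasinorm before the root is taken. The power series represents this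
  quantity, so monotonicity and convexity are first proved for it.\<close>

definition pmean :: "real \<Rightarrow> complex \<Rightarrow> complex \<Rightarrow> real" where
  "pmean q a b = circle_mean (\<lambda>t. cmod (a + b * cis t) powr q)"

lemma continuous_on_norm_powr:
  assumes "q > 0"
  shows "continuous_on S (\<lambda>t. cmod (a + b * cis t) powr q)"
  using assms by (intro continuous_on_powr' continuous_intros) auto

lemma pmean_scale: "pmean q (c * a) (c * b) = cmod c powr q * pmean q a b"
proof -
  have "cmod (c * a + c * b * cis t) powr q = cmod c powr q * cmod (a + b * cis t) powr q" for t
    by (simp add: norm_mult powr_mult mult.assoc flip: distrib_left)
  then show ?thesis
    by (simp add: pmean_def circle_mean_mult_left)
qed

text \<open>Conjugation preserves the modulus, as does multiplication by \<open>cis t\<close>;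
  together they reverse the order of the coefficients.\<close>

lemma norm_swap: "cmod (a + b * cis t) = cmod (cnj b + cnj a * cis t)"
proof -
  have "cmod (a + b * cis t) = cmod (cis t * cnj (a + b * cis t))"
    by (simp add: norm_mult del: complex_cnj_add complex_cnj_mult)
  also have "cis t * cnj (a + b * cis t) = cnj b + cnj a * cis t"
    by (simp add: algebra_simps cis_cnj cis_mult)
  finally show ?thesis .
qed

lemma pmean_swap: "pmean q a b = pmean q (cnj b) (cnj a)"
  unfolding pmean_def by (subst norm_swap) simp

lemma pmean_tendsto:
  assumes "q > 0" "a \<longlonglongrightarrow> a'" "b \<longlonglongrightarrow> b'"
  shows "(\<lambda>n. pmean q (a n) (b n)) \<longlonglongrightarrow> pmean q a' b'"
proof -
  obtain A where A: "norm (a n) \<le> A" for n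
    using convergent_imp_Bseq[OF convergentI[OF assms(2)]] by (auto simp: Bseq_def)
  obtain B where B: "norm (b n) \<le> B" for n
    using convergent_imp_Bseq[OF convergentI[OF assms(3)]] by (auto simp: Bseq_def)
  have "norm (a n + b n * cis t) \<le> A + B" for n t
    using norm_triangle_ineq[of "a n" "b n * cis t"] A[of n] B[of n] by (simp add: norm_mult)
  then have bound: "norm (cmod (a n + b n * cis t) powr q) \<le> (A + B) powr q" for n t
    using \<open>q > 0\<close> by (simp add: powr_mono2)
  show ?thesis
    unfolding pmean_def
    by (rule circle_mean_tendsto[OF _ _ _ bound])
      (use assms in \<open>auto intro!: continuous_on_norm_powr tendsto_powr' tendsto_intros\<close>)
qed

text \<open>For \<open>\<bar>w\<bar> < 1\<close> the integrand is the squared modulus of the boundary values of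
  \<open>(1 + w z) powr (q / 2)\<close>, so Parseval applies to the binomial series.\<close>
lemma pmean_sums:
  assumes "cmod w < 1" "q > 0"
  shows "(\<lambda>k. ((q / 2) gchoose k)\<^sup>2 * (cmod w ^ k)\<^sup>2) sums pmean q 1 w"
proof -
  define b where "b k = complex_of_real ((q / 2) gchoose k)" for k
  define S where "S n t = (\<Sum>k<n. (b k * w ^ k) * cis t ^ k)" for n t
  have b: "b k = complex_of_real (q / 2) gchoose k" for k
    unfolding b_def by (simp add: gbinomial_prod_rev)
  have "(\<lambda>n. S n t) \<longlonglongrightarrow> (1 + w * cis t) powr (q / 2)" for t
    using gen_binomial_complex[of "w * cis t" "complex_of_real (q / 2)"] assms
    by (simp add: sums_def S_def b power_mult_distrib norm_mult mult.assoc)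
  then have "(\<lambda>n. (cmod (S n t))\<^sup>2) \<longlonglongrightarrow> (cmod ((1 + w * cis t) powr (q / 2)))\<^sup>2" for t
    by (intro tendsto_intros)
  moreover have "(cmod (z powr (q / 2)))\<^sup>2 = cmod z powr q" for z :: complex
    by (simp add: norm_powr_real_powr' flip: powr_numeral) (simp add: powr_powr)
  ultimately have lim: "(\<lambda>n. (cmod (S n t))\<^sup>2) \<longlonglongrightarrow> cmod (1 + w * cis t) powr q" for t
    by simp
  have summ: "summable (\<lambda>k. cmod (b k * w ^ k))"
  proof -
    \<comment> \<open>Convergence at a radius strictly between \<open>cmod w\<close> and 1 gives
      absolute convergence at \<open>w\<close>. The resulting sum bounds all partial sums uniformly
      in \<open>t\<close>, as dominated convergence requires.\<close>
    obtain r where r: "cmod w < r" "r < 1"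
      using assms dense by blast
    have "summable (\<lambda>k. b k * of_real r ^ k)"
      using gen_binomial_complex[of "of_real r" "complex_of_real (q / 2)"] r norm_ge_zero[of w]
      by (auto simp: b sums_iff simp del: norm_ge_zero)
    from powser_insidea[OF this, of w] show ?thesis
      using r norm_ge_zero[of w] by (simp del: norm_ge_zero)
  qed
  have "cmod (S n t) \<le> (\<Sum>k. cmod (b k * w ^ k))" for n t
  proof -
    have "cmod (S n t) \<le> (\<Sum>k<n. cmod (b k * w ^ k))"
      unfolding S_def by (rule order.trans[OF norm_sum]) (simp add: norm_mult norm_power)
    also have "\<dots> \<le> (\<Sum>k. cmod (b k * w ^ k))"
      by (rule sum_le_suminf[OF summ]) auto
    finally show ?thesis .
  qed
  then have bound: "norm ((cmod (S n t))\<^sup>2) \<le> (\<Sum>k. cmod (b k * w ^ k))\<^sup>2" for n t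
    by (simp add: power_mono)
  have "(\<lambda>n. circle_mean (\<lambda>t. (cmod (S n t))\<^sup>2)) \<longlonglongrightarrow> pmean q 1 w"
    unfolding pmean_def
    by (rule circle_mean_tendsto[OF _ _ lim bound])
      (use assms in \<open>auto intro!: continuous_on_norm_powr continuous_intros simp: S_def\<close>)
  moreover have "circle_mean (\<lambda>t. (cmod (S n t))\<^sup>2) = (\<Sum>k<n. ((q / 2) gchoose k)\<^sup>2 * (cmod w ^ k)\<^sup>2)" for n
    unfolding S_def parseval_sum
    by (simp add: b_def norm_mult norm_power power_mult_distrib)
  ultimately show ?thesis
    by (simp add: sums_def)
qed

lemma pmean_nonneg: "0 \<le> pmean q a b"
  unfolding pmean_def circle_mean_def set_lebesgue_integral_def
  by (intro scaleR_nonneg_nonneg integral_nonneg) auto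

lemma pmean_zero [simp]: "pmean q 1 0 = 1" "pmean q 0 0 = 0"
  by (simp_all add: pmean_def)

text \<open>Factors below 1 that tend to 1. The series is available in the open disc; facts on the
  closed disc are proved for dilated arguments and carried over by continuity of the mean.\<close>

abbreviation dilation :: "nat \<Rightarrow> real" where
  "dilation n \<equiv> real n / real (Suc n)"

lemma pmean_dilation_tendsto:
  assumes "q > 0"
  shows "(\<lambda>n. pmean q 1 (of_real (dilation n) * w)) \<longlonglongrightarrow> pmean q 1 w"
proof -
  have "(\<lambda>n. of_real (dilation n) * w) \<longlonglongrightarrow> of_real 1 * w"
    by (intro tendsto_intros LIMSEQ_n_over_Suc_n)
  then show ?thesis
    using assms by (intro pmean_tendsto) auto
qed

lemma pmean_dilation_sums:
  assumes "cmod w \<le> 1" "q > 0"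
  shows "(\<lambda>k. ((q / 2) gchoose k)\<^sup>2 * ((dilation n * cmod w) ^ k)\<^sup>2) sums pmean q 1 (of_real (dilation n) * w)"
proof -
  have "dilation n * cmod w \<le> dilation n"
    using assms by (intro mult_left_le) auto
  also have "dilation n < 1"
    by simp
  finally have "cmod (of_real (dilation n) * w) < 1"
    by (simp add: norm_mult norm_divide del: of_nat_Suc)
  from pmean_sums[OF this \<open>q > 0\<close>] show ?thesis
    by (simp add: norm_mult norm_divide del: of_nat_Suc)
qed

text \<open>After dilation both sides are sums of the same series, which sees \<open>w\<close> only
  through \<open>cmod w\<close>.\<close>

lemma pmean_radial:
  assumes "cmod w \<le> 1" "q > 0"
  shows "pmean q 1 w = pmean q 1 (of_real (cmod w))"
proof -
  have "pmean q 1 (of_real (dilation n) * w) = pmean q 1 (of_real (dilation n) * of_real (cmod w))" for n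
    using pmean_dilation_sums[OF assms, of n] pmean_dilation_sums[of "of_real (cmod w)" q n] assms
    by (intro sums_unique2) auto
  then show ?thesis
    using pmean_dilation_tendsto[of q w] pmean_dilation_tendsto[of q "of_real (cmod w)"] assms
    by (auto intro: LIMSEQ_unique)
qed

text \<open>The coefficients are squares, so the series can be compared term by term.\<close>

lemma pmean_mono:
  assumes "0 \<le> x" "x \<le> y" "y \<le> 1" "q > 0"
  shows "pmean q 1 (of_real x) \<le> pmean q 1 (of_real y)"
proof (rule LIMSEQ_le[OF pmean_dilation_tendsto pmean_dilation_tendsto])
  have "pmean q 1 (of_real (dilation n) * of_real x) \<le> pmean q 1 (of_real (dilation n) * of_real y)" for n
  proof (rule sums_le)
    show "(\<lambda>k. ((q / 2) gchoose k)\<^sup>2 * ((dilation n * x) ^ k)\<^sup>2) sums pmean q 1 (of_real (dilation n) * of_real x)"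
      using pmean_dilation_sums[of "of_real x" q n] assms by auto
    show "(\<lambda>k. ((q / 2) gchoose k)\<^sup>2 * ((dilation n * y) ^ k)\<^sup>2) sums pmean q 1 (of_real (dilation n) * of_real y)"
      using pmean_dilation_sums[of "of_real y" q n] assms by auto
    show "((q / 2) gchoose k)\<^sup>2 * ((dilation n * x) ^ k)\<^sup>2 \<le> ((q / 2) gchoose k)\<^sup>2 * ((dilation n * y) ^ k)\<^sup>2" for k
      using assms by (intro mult_left_mono power_mono) auto
  qed
  then show "\<exists>N. \<forall>n\<ge>N. pmean q 1 (of_real (dilation n) * of_real x) \<le> pmean q 1 (of_real (dilation n) * of_real y)"
    by blast
qed (use assms in auto)

lemma pmean_ge_1:
  assumes "cmod w \<le> 1" "q > 0"
  shows "1 \<le> pmean q 1 w"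
  using pmean_mono[of 0 "cmod w" q] pmean_radial[of w q] assms by simp

text \<open>Again term by term: the radius enters through the even power \<open>k * 2\<close>, which
  is convex, with a nonnegative coefficient.\<close>

lemma pmean_convex:
  assumes "x \<in> {0..1}" "y \<in> {0..1}" "0 \<le> u" "0 \<le> v" "u + v = 1" "q > 0"
  shows "pmean q 1 (of_real (u * x + v * y)) \<le> u * pmean q 1 (of_real x) + v * pmean q 1 (of_real y)"
proof (rule LIMSEQ_le[OF pmean_dilation_tendsto tendsto_add[OF tendsto_mult_left tendsto_mult_left]])
  have le1: "u * x + v * y \<le> 1"
    using assms convex_bound_le[of x 1 y u v] by auto
  have "pmean q 1 (of_real (dilation n) * of_real (u * x + v * y))
      \<le> u * pmean q 1 (of_real (dilation n) * of_real x) + v * pmean q 1 (of_real (dilation n) * of_real y)" for n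
  proof (rule sums_le)
    let ?s = "\<lambda>x k. ((q / 2) gchoose k)\<^sup>2 * ((dilation n * x) ^ k)\<^sup>2"
    have "cmod (of_real (u * x + v * y)) = u * x + v * y"
      using assms unfolding norm_of_real by auto
    with le1 show "?s (u * x + v * y) sums pmean q 1 (of_real (dilation n) * of_real (u * x + v * y))"
      using pmean_dilation_sums[of "of_real (u * x + v * y)" q n] assms by metis
    show "(\<lambda>k. u * ?s x k + v * ?s y k) sums
        (u * pmean q 1 (of_real (dilation n) * of_real x) + v * pmean q 1 (of_real (dilation n) * of_real y))"
      using pmean_dilation_sums[of "of_real x" q n] pmean_dilation_sums[of "of_real y" q n] assms
      by (intro sums_add sums_mult) auto
    show "?s (u * x + v * y) k \<le> u * ?s x k + v * ?s y k" for k
    proof -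
      have "(u * (dilation n * x) + v * (dilation n * y)) ^ (k * 2)
          \<le> u * (dilation n * x) ^ (k * 2) + v * (dilation n * y) ^ (k * 2)"
        using convex_onD[OF convex_power_even[of "k * 2"], of v "dilation n * x" "dilation n * y"] assms
        by (simp add: eq_diff_eq[symmetric] del: of_nat_Suc)
      then have "((dilation n * (u * x + v * y)) ^ k)\<^sup>2 \<le> u * ((dilation n * x) ^ k)\<^sup>2 + v * ((dilation n * y) ^ k)\<^sup>2"
        by (simp add: power_mult algebra_simps del: of_nat_Suc)
      from mult_left_mono[OF this, of "((q / 2) gchoose k)\<^sup>2"] show ?thesis
        by (simp add: algebra_simps del: of_nat_Suc)
    qed
  qed
  then show "\<exists>N. \<forall>n\<ge>N. pmean q 1 (of_real (dilation n) * of_real (u * x + v * y))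
      \<le> u * pmean q 1 (of_real (dilation n) * of_real x) + v * pmean q 1 (of_real (dilation n) * of_real y)"
    by blast
qed (use assms pmean_dilation_tendsto in auto)

lemma pmean_normalize:
  assumes "a \<noteq> 0" "cmod b \<le> cmod a" "q > 0"
  shows "pmean q a b = cmod a powr q * pmean q 1 (of_real (cmod b / cmod a))"
proof -
  have "pmean q a b = cmod a powr q * pmean q 1 (b / a)"
    using pmean_scale[of q a 1 "b / a"] assms by simp
  also have "pmean q 1 (b / a) = pmean q 1 (of_real (cmod b / cmod a))"
    using pmean_radial[of "b / a" q] assms by (simp add: norm_divide)
  finally show ?thesis .
qed

text \<open>Dividing by \<open>a\<close> leads into the closed disc only if
  \<open>cmod b \<le> cmod a\<close>; \<open>pmean_swap\<close> reduces the other case to this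
  one.\<close>

lemma pmean_norm:
  assumes "q > 0"
  shows "pmean q a b = pmean q (of_real (cmod a)) (of_real (cmod b))"
proof -
  have *: "pmean q a b = pmean q (of_real (cmod a)) (of_real (cmod b))" if "cmod b \<le> cmod a" for a b
  proof (cases "a = 0")
    case False
    then show ?thesis
      using that assms by (simp add: pmean_normalize)
  qed (use that in auto)
  show ?thesis
  proof (cases "cmod b \<le> cmod a")
    case False
    then show ?thesis
      using *[of "cnj a" "cnj b"] pmean_swap[of q a b] pmean_swap[of q "of_real (cmod a)" "of_real (cmod b)"]
      by (metis * complex_cnj_complex_of_real complex_mod_cnj linorder_le_cases)
  qed (rule *)
qed

lemma pmean_commute:
  assumes "q > 0"
  shows "pmean q a b = pmean q b a"
  using pmean_swap[of q a b] pmean_norm[OF assms] complex_mod_cnj by metis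

text \<open>With the larger entry factored out, the remaining mean is at least its value 1 at
  \<open>w = 0\<close>. Definiteness of the quasinorm follows from this bound.\<close>

lemma pmean_ge:
  assumes "q > 0"
  shows "max (cmod a) (cmod b) powr q \<le> pmean q a b"
proof -
  have *: "max (cmod a) (cmod b) powr q \<le> pmean q a b" if "cmod b \<le> cmod a" for a b
  proof (cases "a = 0")
    case False
    then have "1 \<le> pmean q 1 (of_real (cmod b / cmod a))"
      using that assms by (intro pmean_ge_1) (auto simp: norm_divide)
    then show ?thesis
      using that assms False by (simp add: pmean_normalize max_absorb1)
  qed (use that in auto)
  show ?thesis
    using *[of a b] *[of b a] by (metis pmean_commute[OF assms] linorder_le_cases max.commute)
qed

section \<open>Pointwise inequalities\<close>

text \<open>The squared modulus weights \<open>(x + y)\<^sup>2\<close> and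
  \<open>(x - y)\<^sup>2\<close> by \<open>(1 + cos t) / 2\<close> and
  \<open>(1 - cos t) / 2\<close>, both nonnegative.\<close>

lemma norm_add_cis_mono:
  fixes x y x' y' :: real
  assumes "\<bar>x + y\<bar> \<le> \<bar>x' + y'\<bar>" "\<bar>x - y\<bar> \<le> \<bar>x' - y'\<bar>"
  shows "cmod (x + y * cis t) \<le> cmod (x' + y' * cis t)"
proof -
  have *: "(cmod (x + y * cis t))\<^sup>2 = ((x + y)\<^sup>2 * (1 + cos t) + (x - y)\<^sup>2 * (1 - cos t)) / 2" for x y :: real
  proof -
    have "(cmod (x + y * cis t))\<^sup>2 = (x + y * cos t)\<^sup>2 + (y * sin t)\<^sup>2"
      by (simp add: cmod_power2)
    also have "\<dots> = x\<^sup>2 + 2 * x * y * cos t + y\<^sup>2 * ((sin t)\<^sup>2 + (cos t)\<^sup>2)"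
      by (simp add: power2_eq_square algebra_simps del: sin_cos_squared_add sin_cos_squared_add2 sin_cos_squared_add3)
    also have "\<dots> = ((x + y)\<^sup>2 * (1 + cos t) + (x - y)\<^sup>2 * (1 - cos t)) / 2"
      unfolding sin_cos_squared_add by (simp add: power2_eq_square algebra_simps)
    finally show ?thesis .
  qed
  have "(x + y)\<^sup>2 \<le> (x' + y')\<^sup>2" "(x - y)\<^sup>2 \<le> (x' - y')\<^sup>2"
    using assms by (simp_all add: abs_le_square_iff)
  then have "(cmod (x + y * cis t))\<^sup>2 \<le> (cmod (x' + y' * cis t))\<^sup>2"
    unfolding * by (intro divide_right_mono add_mono mult_right_mono) (auto simp: add.commute intro: cos_ge_minus_one[THEN real_0_le_add_iff[THEN iffD2]])
  then show ?thesis
    by (rule power2_le_imp_le) simp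
qed

lemma powr_convex_nonneg:
  fixes x y :: real
  assumes "p \<ge> 1" "0 \<le> x" "0 \<le> y" "0 \<le> u" "0 \<le> v" "u + v = 1"
  shows "(u * x + v * y) powr p \<le> u * x powr p + v * y powr p"
proof -
  \<comment> \<open>If one of the points is 0, its term vanishes and convexity reduces to this
    inequality, which holds because \<open>w powr p \<le> w\<close> on the unit interval.\<close>
  have *: "(w * z) powr p \<le> w * z powr p" if "0 \<le> w" "w \<le> 1" "0 \<le> z" for w z
  proof -
    have "w powr p \<le> w"
      using powr_mono'[of 1 p w] that assms by simp
    then show ?thesis
      using that by (simp add: powr_mult mult_right_mono)
  qed
  consider "x = 0" | "y = 0" | "x > 0" "y > 0"
    using assms by force
  then show ?thesis
  proof cases
    case 3
    then show ?thesis
      using convex_onD[OF powr_convex[OF \<open>p \<ge> 1\<close>], of v x y] assms by (simp add: eq_diff_eq[symmetric])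
  qed (use *[of v y] *[of u x] assms in auto)
qed

section \<open>The quasinorm for finite positive exponents\<close>

definition pnorm :: "real \<Rightarrow> complex \<Rightarrow> complex \<Rightarrow> real" where
  "pnorm q a b = pmean q a b powr (1 / q)"

lemma pnorm_powr: "q > 0 \<Longrightarrow> pnorm q a b powr q = pmean q a b"
  by (simp add: pnorm_def powr_powr pmean_nonneg)

lemma pnorm_scale:
  assumes "q > 0"
  shows "pnorm q (c * a) (c * b) = cmod c * pnorm q a b"
  using assms by (simp add: pnorm_def pmean_scale powr_mult powr_powr pmean_nonneg)

lemma pnorm_ge:
  assumes "q > 0"
  shows "max (cmod a) (cmod b) \<le> pnorm q a b"
proof -
  have "(max (cmod a) (cmod b) powr q) powr (1 / q) \<le> pmean q a b powr (1 / q)"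
    using assms by (intro powr_mono2 pmean_ge) auto
  moreover have "(max (cmod a) (cmod b) powr q) powr (1 / q) = max (cmod a) (cmod b)"
    using assms by (simp add: powr_powr le_max_iff_disj)
  ultimately show ?thesis
    by (simp only: pnorm_def)
qed

lemma pnorm_zero [simp]: "pnorm q 0 0 = 0"
  by (simp add: pnorm_def)

lemma pnorm_eq_0_iff:
  assumes "q > 0"
  shows "pnorm q a b = 0 \<longleftrightarrow> a = 0 \<and> b = 0"
  using pnorm_ge[OF assms, of a b] by (auto simp: max_def split: if_splits)

lemma pnorm_norm: "q > 0 \<Longrightarrow> pnorm q a b = pnorm q (of_real (cmod a)) (of_real (cmod b))"
  using pmean_norm[of q a b] by (simp add: pnorm_def)

lemma pnorm_commute: "q > 0 \<Longrightarrow> pnorm q a b = pnorm q b a"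
  using pmean_commute[of q a b] by (simp add: pnorm_def)

lemma pnorm_nonneg: "0 \<le> pnorm q a b"
  by (simp add: pnorm_def)

text \<open>Minkowski's inequality from convexity of \<open>powr q\<close>: each summand is divided
  by its own norm, and the total is a multiple of a convex combination of the normalized functions.
  A zero summand is split off because the norms become divisors.\<close>

lemma pnorm_triangle_ge_1:
  assumes "q \<ge> 1"
  shows "pnorm q (a + c) (b + d) \<le> pnorm q a b + pnorm q c d"
proof (cases "(a = 0 \<and> b = 0) \<or> (c = 0 \<and> d = 0)")
  case False
  define \<alpha> \<beta> where "\<alpha> = pnorm q a b" and "\<beta> = pnorm q c d"
  have q: "q > 0"
    using assms by simp
  have pos: "\<alpha> > 0" "\<beta> > 0"
    using False pnorm_eq_0_iff[OF q] pnorm_nonneg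
    by (auto simp: \<alpha>_def \<beta>_def order.strict_iff_order)
  define z w where "z t = cmod (a + b * cis t)" and "w t = cmod (c + d * cis t)" for t
  have bound: "cmod ((a + c) + (b + d) * cis t) powr q
      \<le> (\<alpha> + \<beta>) powr q * (\<alpha> / (\<alpha> + \<beta>) * \<alpha> powr - q * z t powr q + \<beta> / (\<alpha> + \<beta>) * \<beta> powr - q * w t powr q)" for t
  proof -
    have "cmod ((a + c) + (b + d) * cis t) = cmod ((a + b * cis t) + (c + d * cis t))"
      by (simp add: algebra_simps)
    also have "\<dots> \<le> z t + w t"
      unfolding z_def w_def by (rule norm_triangle_ineq)
    also have "\<dots> = (\<alpha> + \<beta>) * (\<alpha> / (\<alpha> + \<beta>) * (z t / \<alpha>) + \<beta> / (\<alpha> + \<beta>) * (w t / \<beta>))"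
      using pos by (simp add: add_divide_distrib[symmetric])
    finally have "cmod ((a + c) + (b + d) * cis t) powr q
        \<le> (\<alpha> + \<beta>) powr q * (\<alpha> / (\<alpha> + \<beta>) * (z t / \<alpha>) + \<beta> / (\<alpha> + \<beta>) * (w t / \<beta>)) powr q"
      using pos q by (subst powr_mult[symmetric]) (intro powr_mono2, auto simp: z_def w_def)
    also have "\<dots> \<le> (\<alpha> + \<beta>) powr q * (\<alpha> / (\<alpha> + \<beta>) * (z t / \<alpha>) powr q + \<beta> / (\<alpha> + \<beta>) * (w t / \<beta>) powr q)"
      using pos assms
      by (intro mult_left_mono powr_convex_nonneg) (auto simp: z_def w_def add_divide_distrib[symmetric])
    finally show ?thesis
      using pos by (simp add: powr_divide z_def w_def powr_minus field_simps)
  qed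
  have cont: "continuous_on S (\<lambda>t. z t powr q)" "continuous_on S (\<lambda>t. w t powr q)" for S
    unfolding z_def w_def using q by (auto intro: continuous_on_norm_powr)
  have "pmean q (a + c) (b + d) \<le> circle_mean (\<lambda>t. (\<alpha> + \<beta>) powr q *
      (\<alpha> / (\<alpha> + \<beta>) * \<alpha> powr - q * z t powr q + \<beta> / (\<alpha> + \<beta>) * \<beta> powr - q * w t powr q))"
    unfolding pmean_def using q
    by (intro circle_mean_mono bound continuous_on_norm_powr continuous_intros cont)
  also have "\<dots> = (\<alpha> + \<beta>) powr q *
      (\<alpha> / (\<alpha> + \<beta>) * \<alpha> powr - q * pmean q a b + \<beta> / (\<alpha> + \<beta>) * \<beta> powr - q * pmean q c d)"
    unfolding pmean_def z_def[symmetric] w_def[symmetric]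
    by (simp only: circle_mean_mult_left circle_mean_add continuous_on_mult_left cont)
  \<comment> \<open>By the choice of \<alpha> and \<beta>, the normalized \<open>q\<close>-th powers
    both have mean 1.\<close>
  also have "\<dots> = (\<alpha> + \<beta>) powr q * (\<alpha> / (\<alpha> + \<beta>) + \<beta> / (\<alpha> + \<beta>))"
    using pos by (simp add: pnorm_powr[OF q, symmetric] \<alpha>_def[symmetric] \<beta>_def[symmetric] mult.assoc powr_add[symmetric])
  also have "\<dots> = (\<alpha> + \<beta>) powr q"
    using pos by (simp add: add_divide_distrib[symmetric])
  finally have "pmean q (a + c) (b + d) powr (1 / q) \<le> ((\<alpha> + \<beta>) powr q) powr (1 / q)"
    using q by (intro powr_mono2) (auto simp: pmean_nonneg)
  then show ?thesis
    using pos q by (simp add: pnorm_def[symmetric] powr_powr \<alpha>_def \<beta>_def)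
qed auto

lemma pnorm_sum_diff_mono:
  fixes x y x' y' :: real
  assumes "q > 0" "\<bar>x + y\<bar> \<le> \<bar>x' + y'\<bar>" "\<bar>x - y\<bar> \<le> \<bar>x' - y'\<bar>"
  shows "pnorm q (of_real x) (of_real y) \<le> pnorm q (of_real x') (of_real y')"
proof -
  have "pmean q (of_real x) (of_real y) \<le> pmean q (of_real x') (of_real y')"
    unfolding pmean_def using assms
    by (intro circle_mean_mono continuous_on_norm_powr powr_mono2 norm_add_cis_mono) auto
  then show ?thesis
    unfolding pnorm_def using assms by (intro powr_mono2 pmean_nonneg) auto
qed

lemma pnorm_normalize:
  fixes a b :: real
  assumes "0 \<le> a" "a \<le> b" "q > 0"
  shows "pnorm q (of_real a) (of_real b) = b * pnorm q 1 (of_real (a / b))"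
proof (cases "b = 0")
  case False
  then have "complex_of_real b * of_real (a / b) = of_real a"
    by simp
  then have "pnorm q (of_real b) (of_real a) = b * pnorm q 1 (of_real (a / b))"
    using pnorm_scale[OF \<open>q > 0\<close>, of "of_real b" 1 "of_real (a / b)"] assms by simp
  then show ?thesis
    using pnorm_commute[OF \<open>q > 0\<close>, of "of_real a" "of_real b"] by simp
qed (use assms in auto)

text \<open>From the diagonal on, increasing the first entry increases both the sum and the
  difference of the entries. Below the diagonal the difference shrinks in modulus, so monotonicity
  of the mean in the ratio \<open>x / b\<close> is used instead. The two ranges meet at
  \<open>b\<close>.\<close>

lemma pnorm_mono_left:
  fixes a a' b :: real
  assumes "0 \<le> a" "a \<le> a'" "0 \<le> b" "q > 0"
  shows "pnorm q (of_real a) (of_real b) \<le> pnorm q (of_real a') (of_real b)"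
proof -
  have above: "pnorm q (of_real x) (of_real b) \<le> pnorm q (of_real y) (of_real b)" if "b \<le> x" "x \<le> y" for x y
    using that assms by (intro pnorm_sum_diff_mono) auto
  have below: "pnorm q (of_real x) (of_real b) \<le> pnorm q (of_real y) (of_real b)" if "0 \<le> x" "x \<le> y" "y \<le> b" for x y
  proof (cases "b = 0")
    case False
    then have "pmean q 1 (of_real (x / b)) \<le> pmean q 1 (of_real (y / b))"
      using that assms by (intro pmean_mono divide_right_mono) auto
    then have "pnorm q 1 (of_real (x / b)) \<le> pnorm q 1 (of_real (y / b))"
      unfolding pnorm_def using assms by (intro powr_mono2 pmean_nonneg) auto
    then show ?thesis
      using that assms by (simp only: pnorm_normalize mult_left_mono)
  qed (use that above[of x y] in auto)
  consider "b \<le> a" | "a' \<le> b" | "a \<le> b" "b \<le> a'"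
    by linarith
  then show ?thesis
  proof cases
    case 3
    then show ?thesis
      using below[of a b] above[of b a'] assms by linarith
  qed (use above below assms in auto)
qed

lemma pnorm_mono:
  fixes a a' b b' :: real
  assumes "0 \<le> a" "a \<le> a'" "0 \<le> b" "b \<le> b'" "q > 0"
  shows "pnorm q (of_real a) (of_real b) \<le> pnorm q (of_real a') (of_real b')"
  using pnorm_mono_left[of a a' b q] pnorm_mono_left[of b b' a' q] assms
    pnorm_commute[of q "of_real a'" "of_real b"] pnorm_commute[of q "of_real a'" "of_real b'"]
  by simp

text \<open>Since \<open>1 / q \<ge> 1\<close>, the outer power is increasing and convex, and it is
  composed with a convex mean.\<close>

lemma pnorm_convex:
  fixes x y u v :: real
  assumes "x \<in> {0..1}" "y \<in> {0..1}" "0 \<le> u" "0 \<le> v" "u + v = 1" "0 < q" "q \<le> 1"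
  shows "pnorm q 1 (of_real (u * x + v * y)) \<le> u * pnorm q 1 (of_real x) + v * pnorm q 1 (of_real y)"
proof -
  have "pnorm q 1 (of_real (u * x + v * y))
      \<le> (u * pmean q 1 (of_real x) + v * pmean q 1 (of_real y)) powr (1 / q)"
    unfolding pnorm_def using assms by (intro powr_mono2 pmean_convex pmean_nonneg) auto
  also have "\<dots> \<le> u * pnorm q 1 (of_real x) + v * pnorm q 1 (of_real y)"
    unfolding pnorm_def using assms by (intro powr_convex_nonneg pmean_nonneg) auto
  finally show ?thesis .
qed

text \<open>On this sector the quasinorm is \<open>b\<close> times a convex function of
  \<open>a / b\<close>, the perspective of that function, and perspectives of convex functions are
  subadditive.\<close>

lemma pnorm_triangle_sector:
  fixes a b c d :: real
  assumes "0 \<le> a" "a \<le> b" "0 \<le> c" "c \<le> d" "0 < q" "q \<le> 1"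
  shows "pnorm q (of_real (a + c)) (of_real (b + d)) \<le> pnorm q (of_real a) (of_real b) + pnorm q (of_real c) (of_real d)"
proof (cases "b = 0 \<or> d = 0")
  case False
  then have pos: "b > 0" "d > 0"
    using assms by auto
  have "(a + c) / (b + d) = b / (b + d) * (a / b) + d / (b + d) * (c / d)"
    using pos by (simp add: add_divide_distrib)
  then have "pnorm q 1 (of_real ((a + c) / (b + d)))
      \<le> b / (b + d) * pnorm q 1 (of_real (a / b)) + d / (b + d) * pnorm q 1 (of_real (c / d))"
    using pos assms by (simp only:) (intro pnorm_convex, auto simp: add_divide_distrib[symmetric])
  then have "(b + d) * pnorm q 1 (of_real ((a + c) / (b + d)))
      \<le> (b + d) * (b / (b + d) * pnorm q 1 (of_real (a / b)) + d / (b + d) * pnorm q 1 (of_real (c / d)))"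
    using pos by (intro mult_left_mono) auto
  also have "\<dots> = b * pnorm q 1 (of_real (a / b)) + d * pnorm q 1 (of_real (c / d))"
    using pos by (simp add: distrib_left)
  finally show ?thesis
    using assms pnorm_normalize[of a b q] pnorm_normalize[of c d q] pnorm_normalize[of "a + c" "b + d" q] by simp
qed (use assms in auto)

text \<open>When the two summands lie on different sides of the diagonal, exchanging the coordinates of one
  of them preserves the sum of the entries of the total and increases the modulus of their difference.\<close>
lemma pnorm_triangle_quadrant:
  fixes a b c d :: real
  assumes "0 \<le> a" "0 \<le> b" "0 \<le> c" "0 \<le> d" "0 < q" "q \<le> 1"
  shows "pnorm q (of_real (a + c)) (of_real (b + d)) \<le> pnorm q (of_real a) (of_real b) + pnorm q (of_real c) (of_real d)"
proof -
  have *: "pnorm q (of_real (a + c)) (of_real (b + d)) \<le> pnorm q (of_real a) (of_real b) + pnorm q (of_real c) (of_real d)"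
    if "a \<le> b" "0 \<le> a" "0 \<le> c" "0 \<le> d" for a b c d :: real
  proof (cases "c \<le> d")
    case False
    have "pnorm q (of_real (a + c)) (of_real (b + d)) \<le> pnorm q (of_real (a + d)) (of_real (b + c))"
      using False that assms by (intro pnorm_sum_diff_mono) auto
    also have "\<dots> \<le> pnorm q (of_real a) (of_real b) + pnorm q (of_real d) (of_real c)"
      using False that assms by (intro pnorm_triangle_sector) auto
    finally show ?thesis
      using pnorm_commute[of q "of_real c" "of_real d"] assms by simp
  qed (use that assms pnorm_triangle_sector in auto)
  show ?thesis
  proof (cases "a \<le> b")
    case False
    then show ?thesis
      using *[of b a d c] assms pnorm_commute[OF \<open>0 < q\<close>] by simp
  qed (use * assms in auto)
qed

text \<open>For \<open>q < 1\<close>, passing to moduli reduces the claim to the quadrant;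
  monotonicity absorbs the triangle inequality in each coordinate.\<close>

lemma pnorm_triangle:
  assumes "q > 0"
  shows "pnorm q (a + c) (b + d) \<le> pnorm q a b + pnorm q c d"
proof (cases "q \<ge> 1")
  case False
  have "pnorm q (a + c) (b + d) = pnorm q (of_real (cmod (a + c))) (of_real (cmod (b + d)))"
    using assms by (rule pnorm_norm)
  also have "\<dots> \<le> pnorm q (of_real (cmod a + cmod c)) (of_real (cmod b + cmod d))"
    using assms by (intro pnorm_mono norm_triangle_ineq) auto
  also have "\<dots> \<le> pnorm q (of_real (cmod a)) (of_real (cmod b)) + pnorm q (of_real (cmod c)) (of_real (cmod d))"
    using assms False by (intro pnorm_triangle_quadrant) auto
  also have "\<dots> = pnorm q a b + pnorm q c d"
    using pnorm_norm[OF assms, of a b] pnorm_norm[OF assms, of c d] by simp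
  finally show ?thesis .
qed (rule pnorm_triangle_ge_1)

section \<open>The Mahler measure of a linear polynomial\<close>

text \<open>With \<open>a\<close> factored out, the logarithm of the modulus is the real part of the
  series of \<open>ln (1 + w z)\<close>. That series has only positive frequencies, each of mean
  zero.\<close>

lemma circle_mean_ln_norm_less:
  assumes "cmod b < cmod a"
  shows "circle_mean (\<lambda>t. ln (cmod (a + b * cis t))) = ln (cmod a)"
proof -
  define w where "w = b / a"
  \<comment> \<open>At \<open>k = 0\<close> the division by zero yields 0, which is the correct
    constant term.\<close>
  define c where "c k = (-1) ^ Suc k / of_nat k * w ^ k" for k
  define S where "S n t = (\<Sum>k<n. c k * cis t ^ k)" for n t
  have a: "a \<noteq> 0" and w: "cmod w < 1"
    using assms norm_ge_zero[of b] by (auto simp: w_def norm_divide divide_less_eq_1 simp del: norm_ge_zero)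
  have nz: "1 + w * cis t \<noteq> 0" for t
  proof
    assume "1 + w * cis t = 0"
    then have "cmod (w * cis t) = cmod (-1)"
      by (simp add: add_eq_0_iff)
    with w show False
      by (simp add: norm_mult)
  qed
  have lim: "(\<lambda>n. Re (S n t)) \<longlonglongrightarrow> ln (cmod (1 + w * cis t))" for t
  proof -
    have "(\<lambda>n. S n t) \<longlonglongrightarrow> ln (1 + w * cis t)"
      using Ln_series[of "w * cis t"] w
      by (simp add: sums_def S_def c_def power_mult_distrib norm_mult mult.assoc)
    then have "(\<lambda>n. Re (S n t)) \<longlonglongrightarrow> Re (ln (1 + w * cis t))"
      by (rule tendsto_Re)
    then show ?thesis
      using nz by simp
  qed
  have bound: "norm (Re (S n t)) \<le> 1 / (1 - cmod w)" for n t
  proof -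
    have "norm (Re (S n t)) \<le> cmod (S n t)"
      by (simp add: abs_Re_le_cmod)
    also have "\<dots> \<le> (\<Sum>k<n. cmod w ^ k)"
      unfolding S_def
    proof (rule sum_norm_le)
      fix k
      have "1 / real k \<le> 1"
        by (cases k) auto
      then have "1 / real k * cmod w ^ k \<le> 1 * cmod w ^ k"
        by (intro mult_right_mono) auto
      then show "cmod (c k * cis t ^ k) \<le> cmod w ^ k"
        by (simp add: c_def norm_mult norm_power norm_divide)
    qed
    also have "\<dots> \<le> (\<Sum>k. cmod w ^ k)"
      using w by (intro sum_le_suminf) auto
    also have "\<dots> = 1 / (1 - cmod w)"
      using w by (intro suminf_geometric) auto
    finally show ?thesis .
  qed
  have cont: "continuous_on X (\<lambda>t. ln (cmod (1 + w * cis t)))" for X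
    using nz by (intro continuous_intros) auto
  have "circle_mean (\<lambda>t. Re (S n t)) = 0" for n
  proof -
    have "circle_mean (S n) = (\<Sum>k<n. c k * circle_mean (\<lambda>t. cis (of_int (int k) * t)))"
      unfolding S_def Complex.DeMoivre
      by (subst circle_mean_sum) (auto intro!: continuous_intros simp: circle_mean_mult_left)
    also have "\<dots> = 0"
      unfolding circle_mean_cis by (intro sum.neutral) (auto simp: c_def)
    finally show ?thesis
      by (subst circle_mean_Re) (auto intro!: continuous_intros simp: S_def)
  qed
  moreover have "(\<lambda>n. circle_mean (\<lambda>t. Re (S n t))) \<longlonglongrightarrow> circle_mean (\<lambda>t. ln (cmod (1 + w * cis t)))"
    by (rule circle_mean_tendsto[OF _ cont lim bound]) (auto intro!: continuous_intros simp: S_def)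
  ultimately have "circle_mean (\<lambda>t. ln (cmod (1 + w * cis t))) = 0"
    by (simp add: LIMSEQ_const_iff)
  moreover have "ln (cmod (a + b * cis t)) = ln (cmod a) + ln (cmod (1 + w * cis t))" for t
  proof -
    have "a + b * cis t = a * (1 + w * cis t)"
      using a by (simp add: w_def distrib_left)
    then show ?thesis
      using a nz by (simp add: norm_mult ln_mult)
  qed
  ultimately show ?thesis
    by (simp add: circle_mean_add cont)
qed

text \<open>Any two zeros differ by a multiple of \<open>2 * pi\<close>. The zeros thus form a null
  set, so pointwise limits of logarithms are required only off them.\<close>

lemma countable_cis_vimage: "countable {t. a + b * cis t = 0}" if "b \<noteq> 0"
proof (cases "{t. a + b * cis t = 0} = {}")
  case False
  then obtain s where s: "a + b * cis s = 0"
    by blast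
  have "{t. a + b * cis t = 0} \<subseteq> range (\<lambda>n::int. s + of_int n * 2 * pi)"
  proof
    fix t assume "t \<in> {t. a + b * cis t = 0}"
    then have "b * cis t = b * cis s"
      using s by (simp add: add_eq_0_iff)
    then have "cis t = cis s"
      using that by simp
    then have "cis t / cis s = 1"
      by simp
    then have "Re (cis (t - s)) = 1"
      by (simp add: cis_divide)
    then obtain n :: int where "t - s = of_int n * 2 * pi"
      by (auto simp: cos_one_2pi_int)
    then show "t \<in> range (\<lambda>n::int. s + of_int n * 2 * pi)"
      by (auto intro!: image_eqI[of _ _ n])
  qed
  then show ?thesis
    by (rule countable_subset) simp
qed (metis countable_empty)

text \<open>If \<open>\<bar>a\<bar> = \<bar>b\<bar>\<close>, then \<open>\<bar>a + r b z\<bar>\<^sup>2 / r = \<bar>a\<bar>\<^sup>2 (r + 1 / r) + c(z)\<close> decreases as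
  \<open>r\<close> increases to \<open>1\<close>; hence the case \<open>\<bar>a\<bar> = \<bar>b\<bar>\<close> follows by monotone convergence.\<close>
lemma circle_mean_ln_norm_eq:
  assumes "cmod b = cmod a" "a \<noteq> 0"
  shows "circle_mean (\<lambda>t. ln (cmod (a + b * cis t))) = ln (cmod a)"
proof -
  \<comment> \<open>The shift by one makes \<open>r 0 = 1 / 2\<close>, so that
    \<open>ln (r n)\<close> and \<open>1 / r n\<close> are always meaningful.\<close>
  define r where "r n = dilation (Suc n)" for n
  \<comment> \<open>Minus half the logarithm of
    \<open>(cmod (a + r n * b * cis t))\<^sup>2 / r n\<close>; the sign makes the sequence
    increasing.\<close>
  define h where "h n t = ln (r n) / 2 - ln (cmod (a + r n * b * cis t))" for n t
  have r: "0 < r n" "r n < 1" for n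
    by (auto simp: r_def)
  have r_lim: "r \<longlonglongrightarrow> 1"
    unfolding r_def using LIMSEQ_Suc[OF LIMSEQ_n_over_Suc_n[where ?'a = real]] by simp
  have r_mono: "r m \<le> r n" if "m \<le> n" for m n
    using that by (simp add: r_def field_simps)
  have nz: "a + r n * b * cis t \<noteq> 0" for n t
  proof
    assume "a + r n * b * cis t = 0"
    then have "cmod (r n * b * cis t) = cmod (- a)"
      by (simp add: add_eq_0_iff)
    then show False
      using r[of n] assms by (simp add: norm_mult)
  qed
  have h_eq: "h n t = - ln ((cmod a)\<^sup>2 * (r n + 1 / r n) + 2 * Re (cnj a * b * cis t)) / 2" for n t
  proof -
    have "(cmod (u + v))\<^sup>2 = (cmod u)\<^sup>2 + (cmod v)\<^sup>2 + 2 * Re (cnj u * v)" for u v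
      unfolding cmod_power2 by (simp add: power2_eq_square algebra_simps)
    then have "(cmod (a + r n * b * cis t))\<^sup>2 = (cmod a)\<^sup>2 + (cmod (r n * b * cis t))\<^sup>2 + 2 * Re (cnj a * (r n * b * cis t))" .
    also have "\<dots> = r n * ((cmod a)\<^sup>2 * (r n + 1 / r n) + 2 * Re (cnj a * b * cis t))"
      using r[of n] assms by (simp add: norm_mult power2_eq_square field_simps)
    finally have *: "(cmod (a + r n * b * cis t))\<^sup>2 = \<dots>" .
    have "(cmod a)\<^sup>2 * (r n + 1 / r n) + 2 * Re (cnj a * b * cis t) > 0"
      using * nz[of n t] r[of n] by (metis zero_less_mult_pos zero_less_norm_iff zero_less_power)
    then have "ln ((cmod (a + r n * b * cis t))\<^sup>2) = ln (r n) + ln ((cmod a)\<^sup>2 * (r n + 1 / r n) + 2 * Re (cnj a * b * cis t))"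
      unfolding * using r[of n] by (simp add: ln_mult)
    moreover have "ln ((cmod (a + r n * b * cis t))\<^sup>2) = 2 * ln (cmod (a + r n * b * cis t))"
      using nz by (simp add: ln_realpow)
    ultimately show ?thesis
      by (simp add: h_def)
  qed
  have h_mono: "mono (\<lambda>n. h n t)" for t
  proof (rule monoI)
    fix m n :: nat assume "m \<le> n"
    \<comment> \<open>Divided by \<open>r m * r n\<close>, this product is the decrease of
      \<open>r + 1 / r\<close> from \<open>r m\<close> to \<open>r n\<close>.\<close>
    have "(r n - r m) * (1 - r m * r n) \<ge> 0"
      using r_mono[OF \<open>m \<le> n\<close>] r[of m] r[of n] by (intro mult_nonneg_nonneg) (auto simp: mult_le_one)
    then have "r n + 1 / r n \<le> r m + 1 / r m"
      using r[of m] r[of n] by (simp add: field_simps)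
    then have le: "(cmod a)\<^sup>2 * (r n + 1 / r n) + 2 * Re (cnj a * b * cis t)
        \<le> (cmod a)\<^sup>2 * (r m + 1 / r m) + 2 * Re (cnj a * b * cis t)"
      by (simp add: mult_left_mono)
    have "0 < (cmod a)\<^sup>2 * (r n + 1 / r n) + 2 * Re (cnj a * b * cis t)"
    proof -
      \<comment> \<open>The cross term is at least \<open>- 2 * (cmod a)\<^sup>2\<close>, so
        positivity follows from \<open>r n + 1 / r n > 2\<close>.\<close>
      have "0 < (cmod a)\<^sup>2 * ((r n + 1 / r n) - 2)"
      proof -
        have "0 < (1 - r n)\<^sup>2 / r n"
          using r[of n] by simp
        also have "\<dots> = (r n + 1 / r n) - 2"
          using r[of n] by (simp add: power2_eq_square field_simps)
        finally show ?thesis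
          using assms by simp
      qed
      moreover have "\<bar>Re (cnj a * b * cis t)\<bar> \<le> (cmod a)\<^sup>2"
        using abs_Re_le_cmod[of "cnj a * b * cis t"] assms by (simp add: norm_mult power2_eq_square)
      ultimately show ?thesis
        by (simp add: algebra_simps abs_le_iff)
    qed
    with le show "h m t \<le> h n t"
      unfolding h_eq by (simp add: divide_right_mono)
  qed
  have h_lim: "(\<lambda>n. h n t) \<longlonglongrightarrow> - ln (cmod (a + b * cis t))" if "a + b * cis t \<noteq> 0" for t
  proof -
    have "(\<lambda>n. h n t) \<longlonglongrightarrow> ln 1 / 2 - ln (cmod (a + of_real 1 * b * cis t))"
      unfolding h_def using that by (intro tendsto_intros r_lim) auto
    then show ?thesis
      by simp
  qed
  have cont: "continuous_on X (h n)" for X n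
    unfolding h_def using nz by (intro continuous_intros) auto
  have "(\<lambda>n. circle_mean (h n)) \<longlonglongrightarrow> ln 1 / 2 - ln (cmod a)"
  proof -
    have "circle_mean (h n) = ln (r n) / 2 - ln (cmod a)" for n
    proof -
      have "circle_mean (\<lambda>t. ln (cmod (a + r n * b * cis t))) = ln (cmod a)"
        using r[of n] assms by (intro circle_mean_ln_norm_less) (simp add: norm_mult)
      moreover have "circle_mean (\<lambda>t. ln (r n) / 2 + - ln (cmod (a + r n * b * cis t)))
          = ln (r n) / 2 + - circle_mean (\<lambda>t. ln (cmod (a + r n * b * cis t)))"
        using nz by (subst circle_mean_add) (auto intro!: continuous_intros simp: circle_mean_minus)
      ultimately show ?thesis
        by (simp add: h_def[abs_def])
    qed
    then show ?thesis
      by (simp only:) (intro tendsto_intros r_lim, auto)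
  qed
  then have "(\<lambda>n. (2 * pi) *\<^sub>R circle_mean (h n)) \<longlonglongrightarrow> (2 * pi) *\<^sub>R (- ln (cmod a))"
    by (intro tendsto_intros) auto
  then have ilim: "(\<lambda>n. LBINT t. indicator {0..2 * pi} t *\<^sub>R h n t) \<longlonglongrightarrow> (2 * pi) *\<^sub>R (- ln (cmod a))"
    by (simp add: circle_mean_def set_lebesgue_integral_def)
  have "(LBINT t. indicator {0..2 * pi} t *\<^sub>R (- ln (cmod (a + b * cis t)))) = (2 * pi) *\<^sub>R (- ln (cmod a))"
  proof (rule integral_monotone_convergence[OF _ _ _ ilim])
    show "integrable lborel (\<lambda>t. indicator {0..2 * pi} t *\<^sub>R h n t)" for n
      using borel_integrable_atLeastAtMost'[OF cont] by (simp add: set_integrable_def)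
    show "AE t in lborel. mono (\<lambda>n. indicator {0..2 * pi} t *\<^sub>R h n t)"
      using h_mono by (intro AE_I2) (auto simp: mono_def indicator_def)
    have "b \<noteq> 0"
      using assms by auto
    \<comment> \<open>At a zero \<open>h n t\<close> tends to infinity, whereas the limit function
      has the value \<open>- ln 0 = 0\<close> there.\<close>
    then have "AE t in lborel. t \<notin> {t. a + b * cis t = 0}"
      by (intro AE_not_in countable_imp_null_set_lborel countable_cis_vimage)
    then show "AE t in lborel. (\<lambda>n. indicator {0..2 * pi} t *\<^sub>R h n t) \<longlonglongrightarrow>
        indicator {0..2 * pi} t *\<^sub>R (- ln (cmod (a + b * cis t)))"
      by eventually_elim (intro tendsto_scaleR tendsto_const h_lim, simp)
    have "(\<lambda>t. a + b * cis t) \<in> borel_measurable borel"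
      by (intro borel_measurable_continuous_onI continuous_intros)
    then show "(\<lambda>t. indicator {0..2 * pi} t *\<^sub>R (- ln (cmod (a + b * cis t)))) \<in> borel_measurable lborel"
      by measurable
  qed
  then show ?thesis
    by (simp add: circle_mean_def set_lebesgue_integral_def)
qed

text \<open>Jensen's formula for \<open>a + b z\<close>; if \<open>b\<close> is the larger entry,
  \<open>norm_swap\<close> exchanges the roles.\<close>

lemma circle_mean_ln_norm:
  assumes "(a, b) \<noteq> (0, 0)"
  shows "circle_mean (\<lambda>t. ln (cmod (a + b * cis t))) = ln (max (cmod a) (cmod b))"
proof -
  have *: "circle_mean (\<lambda>t. ln (cmod (a + b * cis t))) = ln (cmod a)" if "a \<noteq> 0" "cmod b \<le> cmod a" for a b
    using that circle_mean_ln_norm_less[of b a] circle_mean_ln_norm_eq[of b a] by (auto simp: order_le_less)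
  show ?thesis
  proof (cases "cmod b \<le> cmod a")
    case True
    then show ?thesis
      using assms by (subst *) (auto simp: max_absorb1)
  next
    case False
    then have "circle_mean (\<lambda>t. ln (cmod (cnj b + cnj a * cis t))) = ln (cmod (cnj b))"
      by (intro *) auto
    then show ?thesis
      using False by (subst norm_swap) (simp add: max_absorb2)
  qed
qed

section \<open>Evaluation of \<open>hardy_norm\<close> for the three kinds of exponent\<close>

lemma hardy_norm_0: "hardy_norm 0 (a, b) = max (cmod a) (cmod b)"
proof (cases "(a, b) = (0, 0)")
  case False
  then have "max (cmod a) (cmod b) > 0"
    by (auto simp: less_max_iff_disj)
  then show ?thesis
    using circle_mean_ln_norm[OF False] False by (auto simp: hardy_norm_def circle_mean_def cis_conv_exp)
qed (simp add: hardy_norm_def)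

lemma hardy_norm_top: "hardy_norm \<infinity> (a, b) = cmod a + cmod b"
proof -
  have "(SUP t::real. cmod (a + b * cis t)) = cmod a + cmod b"
  proof (rule cSup_eq_maximum)
    \<comment> \<open>This angle turns \<open>b\<close> into the direction of \<open>a\<close>, so
      the triangle inequality becomes an equality and the supremum is attained.\<close>
    have "a + b * cis (Arg a - Arg b) = (cmod a + cmod b) * cis (Arg a)"
    proof -
      have "b * cis (Arg a - Arg b) = cmod b * cis (Arg a)"
        using rcis_cmod_Arg[of b]
        by (metis cis_mult diff_add_cancel add.commute mult.assoc rcis_def)
      then show ?thesis
        using rcis_cmod_Arg[of a] by (simp add: rcis_def distrib_right)
    qed
    then have "cmod (a + b * cis (Arg a - Arg b)) = cmod a + cmod b"
      by (simp add: norm_mult flip: of_real_add)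
    then show "cmod a + cmod b \<in> range (\<lambda>t. cmod (a + b * cis t))"
      by (metis rangeI)
    show "x \<le> cmod a + cmod b" if "x \<in> range (\<lambda>t. cmod (a + b * cis t))" for x
      using that norm_triangle_ineq[of a "b * cis t" for t] by (auto simp: norm_mult)
  qed
  then show ?thesis
    by (simp add: hardy_norm_def cis_conv_exp)
qed

lemma hardy_norm_pnorm:
  assumes "p \<noteq> 0" "p \<noteq> \<infinity>"
  shows "hardy_norm p (a, b) = pnorm (enn2real p) a b"
  using assms by (simp add: hardy_norm_def pnorm_def pmean_def circle_mean_def cis_conv_exp)

theorem theorem2p1:
  fixes p :: ennreal
  shows "is_norm_C2 (hardy_norm p) \<and>
         (\<forall>a1 a2 :: complex.
            hardy_norm p (a1, a2) = hardy_norm p (a2, a1) \<and>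
            hardy_norm p (a2, a1) = hardy_norm p (complex_of_real (cmod a1), complex_of_real (cmod a2)))"
proof -
  consider "p = 0" | "p = \<infinity>" | "p \<noteq> 0" "p \<noteq> \<infinity>"
    by blast
  then show ?thesis
  proof cases
    case 1
    have max_triangle: "max (cmod (a + c)) (cmod (b + d)) \<le> max (cmod a) (cmod b) + max (cmod c) (cmod d)"
      for a b c d
      using norm_triangle_ineq[of a c] norm_triangle_ineq[of b d] by linarith
    show ?thesis
      using 1 max_triangle
      by (auto simp: is_norm_C2_def hardy_norm_0 norm_mult max_mult_distrib_left le_max_iff_disj max.commute zero_prod_def)
        (auto simp: max_def split: if_splits)
  next
    case 2
    have N: "hardy_norm p (a, b) = cmod a + cmod b" for a b
      unfolding 2 by (rule hardy_norm_top)
    have "cmod (a + c) + cmod (b + d) \<le> cmod a + cmod b + (cmod c + cmod d)" for a b c d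
      using norm_triangle_ineq[of a c] norm_triangle_ineq[of b d] by linarith
    then show ?thesis
      by (auto simp: is_norm_C2_def N norm_mult distrib_left add_nonneg_eq_0_iff zero_prod_def)
  next
    case 3
    define q where "q = enn2real p"
    have q: "q > 0"
      using 3 by (simp add: q_def enn2real_positive_iff zero_less_iff_neq_zero less_top)
    have N: "hardy_norm p (a, b) = pnorm q a b" for a b
      using 3 by (simp add: q_def hardy_norm_pnorm)
    have "is_norm_C2 (hardy_norm p)"
      using pnorm_eq_0_iff[OF q] pnorm_scale[OF q] pnorm_triangle[OF q]
      by (auto simp: is_norm_C2_def N pnorm_nonneg zero_prod_def)
    then show ?thesis
      using pnorm_commute[OF q] pnorm_norm[OF q] by (metis N)
  qed
qed

end
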